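(* Let $A:\mathbb{X}^\star\to\{C^0\prec\dots\prec C^{p-1}\}$ be an assignment. If $\phi^{SAT}_A$ is unsatisfiable, then $A$ cannot be represented in the model U-NCS, i.e. there is no pair $(\langle b\rangle,\mathcal{T})$, with $\langle b\rangle=(b^1,\dots,b^{p-1})$ a tuple of profiles in $\mathbb{X}$ that is non-decreasing for weak dominance and $\mathcal{T}$ an upset of coalitions of criteria, such that $\text{U-NCS}_{(\langle b\rangle,\mathcal{T})}$ extends $A$.
   Context: Setting. $\mathcal{N}$ is a finite set of criteria; for each $i\in\mathcal{N}$, $(\mathbb{X}_i,\le_i)$ is a totally ordered set; $\mathbb{X}=\prod_{i\in\mathcal{N}}\mathbb{X}_i$ is the set of profiles. A coalition is a subset of $\mathcal{N}$; an upset of coalitions is a family $\mathcal{T}\subseteq 2^{\mathcal{N}}$ such that $B\in\mathcal{T}$ and $B\subseteq B'\subseteq\mathcal{N}$ imply $B'\in\mathcal{T}$. For profiles $x,y$, $O_{\mathcal{N}}(x,y)=\{i\in\mathcal{N}: x_i\ge_i y_i\}$. There are $p$ ordered categories $C^0\prec C^1\prec\dots\prec C^{p-1}$; the profile (frontier) $b^h$, $1\le h\le p-1$, separates $C^{h-1}$ from $C^h$. A tuple $(b^1,\dots,b^{p-1})$ is non-decreasing for weak dominance if $b^1_i\le_i\dots\le_i b^{p-1}_i$ for all $i\in\mathcal{N}$. U-NCS. For $\langle b\rangle=(b^1,\dots,b^{p-1})$ non-decreasing for weak dominance and $\mathcal{T}$ an upset of coalitions, $\text{U-NCS}_{(\langle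 b\rangle,\mathcal{T})}$ maps a profile $x$ to the unique category $C^k$ ($0\le k\le p-1$) such that $O_{\mathcal{N}}(x,b^k)\in\mathcal{T}$ and $O_{\mathcal{N}}(x,b^{k+1})\notin\mathcal{T}$, where by convention the first condition is regarded as always true for $k=0$ and the second as always true for $k=p-1$. Assignment. $\mathbb{X}^\star\subset\mathbb{X}$ is a finite set of reference alternatives, $\mathbb{X}^\star_i=\{x_i:x\in\mathbb{X}^\star\}$, and an assignment $A$ is a function from $\mathbb{X}^\star$ to the set of categories. A sorting function extends $A$ if it coincides with $A$ on $\mathbb{X}^\star$. SAT encoding. $\phi^{SAT}_A$ is the Boolean function of the variables $x_{i,h,k}$ ($i\in\mathcal{N}$, $1\le h\le p-1$, $k\in\mathbb{X}^\star_i$) and $y_B$ ($B\subseteq\mathcal{N}$) given by the conjunction of the following clauses (an empty disjunction is false): (1) for all $i\in\mathcal{N}$, $1\le h\le p-1$, $k<k'$ in $\mathbb{X}^\star_i$: $x_{i,h,k'}\vee\neg x_{i,h,k}$; (2) for all $i\in\mathcal{N}$, $1\le h<h'\le p-1$, $k\in\mathbb{X}^\star_i$: $x_{i,h,k}\vee\neg x_{i,h',k}$; (3) for all $B\subset B'\subseteq\mathcal{N}$: $y_{B'}\vee\neg y_B$; (4) for all $B\subseteq\mathcal{N}$, $1\le h\le p-1$, $u\in\mathbb{X}^\star$ with $A(u)=C^{h-1}$: $(\bigvee_{i\in B}\neg x_{i,h,u_i})\vee\neg y_B$; (5) for all $B\subseteq\mathcal{N}$, $1\le h\le p-1$, $a\in\mathbb{X}^\star$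 with $A(a)=C^{h}$: $(\bigvee_{i\in B}x_{i,h,a_i})\vee y_{\mathcal{N}\setminus B}$. It is satisfiable if some $0/1$ assignment of the variables makes it equal to $1$, and unsatisfiable otherwise. *)

theory Defs
  imports Main "HOL-Library.FuncSet"
begin

text \<open>
  Conventions: \<open>N\<close> is the set of criteria and, for each criterion \<open>i\<close>, the set \<open>X i\<close> carries
  the order \<open>le i\<close> given as a relation, so \<open>(s, t) \<in> le i\<close> means that \<open>s\<close> is at most \<open>t\<close>.
  The category \<open>C\<close> with superscript \<open>k\<close> is represented by the number \<open>k < p\<close>.
\<close>

definition profiles :: "'i set \<Rightarrow> ('i \<Rightarrow> 'a set) \<Rightarrow> ('i \<Rightarrow> 'a) set" where
  "profiles N X = (\<Pi>\<^sub>E i\<in>N. X i)"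

definition upset_of_coalitions :: "'i set \<Rightarrow> 'i set set \<Rightarrow> bool" where
  "upset_of_coalitions N T \<longleftrightarrow>
     T \<subseteq> Pow N \<and> (\<forall>B B'. B \<in> T \<and> B \<subseteq> B' \<and> B' \<subseteq> N \<longrightarrow> B' \<in> T)"

text \<open>The criteria on which \<open>x\<close> is at least as good as \<open>y\<close>.\<close>

definition outranking_coalition ::
    "'i set \<Rightarrow> ('i \<Rightarrow> 'a rel) \<Rightarrow> ('i \<Rightarrow> 'a) \<Rightarrow> ('i \<Rightarrow> 'a) \<Rightarrow> 'i set" where
  "outranking_coalition N le x y = {i \<in> N. (y i, x i) \<in> le i}"

text \<open>Tuples of frontiers are extensional functions on the indices \<open>1, \<dots>, p - 1\<close>.\<close>

definition frontier_tuples ::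
    "'i set \<Rightarrow> ('i \<Rightarrow> 'a set) \<Rightarrow> nat \<Rightarrow> (nat \<Rightarrow> 'i \<Rightarrow> 'a) set" where
  "frontier_tuples N X p = ({1..<p} \<rightarrow>\<^sub>E profiles N X)"

definition nondecreasing_weak_dominance ::
    "'i set \<Rightarrow> ('i \<Rightarrow> 'a rel) \<Rightarrow> nat \<Rightarrow> (nat \<Rightarrow> 'i \<Rightarrow> 'a) \<Rightarrow> bool" where
  "nondecreasing_weak_dominance N le p b \<longleftrightarrow>
     (\<forall>i\<in>N. \<forall>h. 1 \<le> h \<and> Suc h < p \<longrightarrow> (b h i, b (Suc h) i) \<in> le i)"

text \<open>
  The disjunctions \<open>k = 0\<close> and \<open>Suc k = p\<close> implement the convention that the respective
  condition is regarded as true at the two ends; \<open>b 0\<close> and \<open>b p\<close> play no role.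
\<close>

definition U_NCS ::
    "'i set \<Rightarrow> ('i \<Rightarrow> 'a rel) \<Rightarrow> nat \<Rightarrow> (nat \<Rightarrow> 'i \<Rightarrow> 'a) \<Rightarrow> 'i set set \<Rightarrow> ('i \<Rightarrow> 'a) \<Rightarrow> nat" where
  "U_NCS N le p b T x =
     (THE k. k < p \<and>
        (k = 0 \<or> outranking_coalition N le x (b k) \<in> T) \<and>
        (Suc k = p \<or> outranking_coalition N le x (b (Suc k)) \<notin> T))"

definition sorting_extends ::
    "('i \<Rightarrow> 'a) set \<Rightarrow> (('i \<Rightarrow> 'a) \<Rightarrow> nat) \<Rightarrow> (('i \<Rightarrow> 'a) \<Rightarrow> nat) \<Rightarrow> bool" where
  "sorting_extends Xstar A f \<longleftrightarrow> (\<forall>x\<in>Xstar. f x = A x)"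

text \<open>
  The Boolean function of the encoding. The variables are \<open>x i h k\<close> and \<open>y B\<close>; values at
  indices outside the stated ranges do not occur in any clause.
\<close>

definition phi_SAT ::
    "'i set \<Rightarrow> ('i \<Rightarrow> 'a rel) \<Rightarrow> nat \<Rightarrow> ('i \<Rightarrow> 'a) set \<Rightarrow> (('i \<Rightarrow> 'a) \<Rightarrow> nat) \<Rightarrow>
     ('i \<Rightarrow> nat \<Rightarrow> 'a \<Rightarrow> bool) \<Rightarrow> ('i set \<Rightarrow> bool) \<Rightarrow> bool" where
  "phi_SAT N le p Xstar A x y \<longleftrightarrow>
     (\<forall>i\<in>N. \<forall>h\<in>{1..<p}. \<forall>k\<in>(\<lambda>u. u i) ` Xstar. \<forall>k'\<in>(\<lambda>u. u i) ` Xstar.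
        (k, k') \<in> le i \<and> k \<noteq> k' \<longrightarrow> x i h k' \<or> \<not> x i h k) \<and>
     (\<forall>i\<in>N. \<forall>h\<in>{1..<p}. \<forall>h'\<in>{1..<p}. \<forall>k\<in>(\<lambda>u. u i) ` Xstar.
        h < h' \<longrightarrow> x i h k \<or> \<not> x i h' k) \<and>
     (\<forall>B B'. B \<subset> B' \<and> B' \<subseteq> N \<longrightarrow> y B' \<or> \<not> y B) \<and>
     (\<forall>B\<subseteq>N. \<forall>h\<in>{1..<p}. \<forall>u\<in>Xstar.
        A u = h - 1 \<longrightarrow> (\<exists>i\<in>B. \<not> x i h (u i)) \<or> \<not> y B) \<and>
     (\<forall>B\<subseteq>N. \<forall>h\<in>{1..<p}. \<forall>a\<in>Xstar.
        A a = h \<longrightarrow> (\<exists>i\<in>B. x i h (a i)) \<or> y (N - B))"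

definition phi_SAT_satisfiable ::
    "'i set \<Rightarrow> ('i \<Rightarrow> 'a rel) \<Rightarrow> nat \<Rightarrow> ('i \<Rightarrow> 'a) set \<Rightarrow> (('i \<Rightarrow> 'a) \<Rightarrow> nat) \<Rightarrow> bool" where
  "phi_SAT_satisfiable N le p Xstar A \<longleftrightarrow> (\<exists>x y. phi_SAT N le p Xstar A x y)"

end

theory Submission
  imports Defs
begin

text \<open>
  A representation \<open>(b, T)\<close> of \<open>A\<close> yields a model of the encoding: let \<open>x i h k\<close> say that \<open>k\<close> is
  at least \<open>b h i\<close>, and \<open>y B\<close> that \<open>B \<in> T\<close>. Since the frontiers are nested and \<open>T\<close> is an upset,
  the conditions of belonging to \<open>T\<close> get harder as the frontier rises, which makes the category
  well defined; clauses (4) and (5) are then its two defining conditions.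
\<close>

text \<open>The definition compares consecutive frontiers only, so transitivity chains the
  comparisons by induction on \<open>h'\<close>. Keeping \<open>h < h'\<close> strict avoids any
  appeal to reflexivity.\<close>

lemma nondecreasing_weak_dominance_less:
  assumes "nondecreasing_weak_dominance N le p b" "i \<in> N" "trans (le i)"
    and "1 \<le> h" "h < h'" "h' < p"
  shows "(b h i, b h' i) \<in> le i"
  using assms(5,6)
proof (induction h')
  case 0
  then show ?case by simp
next
  case (Suc n)
  have step: "(b n i, b (Suc n) i) \<in> le i"
    using assms(1,2,4) Suc.prems unfolding nondecreasing_weak_dominance_def by simp
  show ?case
  proof (cases "h = n")
    case False
    then have "(b h i, b n i) \<in> le i" using Suc by simp
    then show ?thesis using step assms(3) by (meson transD)
  qed (use step in simp)
qed

text \<open>A value at least \<open>b h' i\<close> is at least the lower \<open>b h i\<close> by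
  transitivity, so raising the frontier can only lose criteria.\<close>

lemma outranking_coalition_antimono:
  assumes "nondecreasing_weak_dominance N le p b" "\<And>i. i \<in> N \<Longrightarrow> trans (le i)"
    and "1 \<le> h" "h \<le> h'" "h' < p"
  shows "outranking_coalition N le x (b h') \<subseteq> outranking_coalition N le x (b h)"
proof (cases "h = h'")
  case False
  then have "(b h i, b h' i) \<in> le i" if "i \<in> N" for i
    using nondecreasing_weak_dominance_less[OF assms(1) that assms(2)[OF that]] assms(3-5) by simp
  then show ?thesis
    unfolding outranking_coalition_def using transD[OF assms(2)] by blast
qed simp

lemma upset_of_coalitionsD:
  assumes "upset_of_coalitions N T" "B \<in> T" "B \<subseteq> B'" "B' \<subseteq> N"
  shows "B' \<in> T"
  using assms unfolding upset_of_coalitions_def by blast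

lemma outranking_coalition_subset: "outranking_coalition N le x y \<subseteq> N"
  unfolding outranking_coalition_def by blast

text \<open>The definite description in \<open>U_NCS\<close> can be used only once exactly one
  category is known to meet both conditions.\<close>

lemma U_NCS_properties:
  assumes "nondecreasing_weak_dominance N le p b" "\<And>i. i \<in> N \<Longrightarrow> trans (le i)"
    and "upset_of_coalitions N T" "p \<ge> 1"
  defines "Q \<equiv> \<lambda>x k. k < p \<and>
      (k = 0 \<or> outranking_coalition N le x (b k) \<in> T) \<and>
      (Suc k = p \<or> outranking_coalition N le x (b (Suc k)) \<notin> T)"
  shows "Q x (U_NCS N le p b T x)"
proof -
  \<comment> \<open>Existence: take the largest index satisfying the lower condition. Its successor
    lies outside \<open>S\<close> and is nonzero, so either it equals \<open>p\<close> or its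
    coalition is not in \<open>T\<close>.\<close>
  define S where "S = {k. k < p \<and> (k = 0 \<or> outranking_coalition N le x (b k) \<in> T)}"
  have S: "finite S" "0 \<in> S" using assms(4) unfolding S_def by auto
  then have "Max S \<in> S" by (auto intro: Max_in)
  moreover have "Suc (Max S) \<notin> S" using Max_ge[OF S(1), of "Suc (Max S)"] by auto
  ultimately have ex: "Q x (Max S)" unfolding S_def Q_def by auto
  \<comment> \<open>Uniqueness: for \<open>k < k'\<close>, the coalition at \<open>k'\<close> lies
    in \<open>T\<close> and inside the one at \<open>Suc k\<close>, which the upset property would
    then force into \<open>T\<close>.\<close>
  have no_less: "\<not> k < k'" if k: "Q x k" and k': "Q x k'" for k k'
  proof
    assume "k < k'"
    with k k' have "outranking_coalition N le x (b k') \<in> T"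
        "outranking_coalition N le x (b (Suc k)) \<notin> T" "Suc k \<le> k'" "k' < p"
      unfolding Q_def by auto
    moreover from this
    have "outranking_coalition N le x (b k') \<subseteq> outranking_coalition N le x (b (Suc k))"
      by (intro outranking_coalition_antimono[OF assms(1,2)]) auto
    ultimately show False
      using upset_of_coalitionsD[OF assms(3) _ _ outranking_coalition_subset] by blast
  qed
  then have "k = Max S" if "Q x k" for k using ex that by (meson linorder_neqE_nat)
  with ex have "Q x (THE k. Q x k)" by (rule theI)
  then show ?thesis unfolding U_NCS_def Q_def .
qed

theorem corollary1:
  fixes N :: "'i set" and X :: "'i \<Rightarrow> 'a set" and le :: "'i \<Rightarrow> 'a rel"
    and p :: nat and Xstar :: "('i \<Rightarrow> 'a) set" and A :: "('i \<Rightarrow> 'a) \<Rightarrow> nat"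
  assumes "finite N"
    and "\<And>i. i \<in> N \<Longrightarrow> linear_order_on (X i) (le i)"
    and "p \<ge> 1"
    and "finite Xstar"
    and "Xstar \<subseteq> profiles N X"
    and "A \<in> Xstar \<rightarrow> {..<p}"
    and "\<not> phi_SAT_satisfiable N le p Xstar A"
  shows "\<not> (\<exists>b T. b \<in> frontier_tuples N X p \<and>
                nondecreasing_weak_dominance N le p b \<and>
                upset_of_coalitions N T \<and>
                sorting_extends Xstar A (U_NCS N le p b T))"
proof
  assume "\<exists>b T. b \<in> frontier_tuples N X p \<and>
                nondecreasing_weak_dominance N le p b \<and>
                upset_of_coalitions N T \<and>
                sorting_extends Xstar A (U_NCS N le p b T)"
  then obtain b T where b: "nondecreasing_weak_dominance N le p b"
    and T: "upset_of_coalitions N T"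
    and ext: "sorting_extends Xstar A (U_NCS N le p b T)" by blast
  have tr: "trans (le i)" if "i \<in> N" for i
    using assms(2)[OF that] by (simp add: order_on_defs)
  let ?O = "\<lambda>u h. outranking_coalition N le u (b h)"
  have A: "A u = 0 \<or> ?O u (A u) \<in> T" "Suc (A u) = p \<or> ?O u (Suc (A u)) \<notin> T"
    if "u \<in> Xstar" for u
    using U_NCS_properties[OF b tr T assms(3), of u] ext that
    unfolding sorting_extends_def by auto
  let ?x = "\<lambda>i h k. (b h i, k) \<in> le i"
  have "phi_SAT N le p Xstar A ?x (\<lambda>B. B \<in> T)"
    unfolding phi_SAT_def
  proof (intro conjI ballI allI impI)
    fix i h k k' assume "i \<in> N" "(k, k') \<in> le i \<and> k \<noteq> k'"
    then show "?x i h k' \<or> \<not> ?x i h k" using transD[OF tr] by blast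
  next
    fix i h h' k assume "i \<in> N" "h \<in> {1..<p}" "h' \<in> {1..<p}" "h < h'"
    then show "?x i h k \<or> \<not> ?x i h' k"
      using nondecreasing_weak_dominance_less[OF b _ tr, of i h h'] transD[OF tr]
      by (metis atLeastLessThan_iff)
  next
    fix B B' assume "B \<subset> B' \<and> B' \<subseteq> N"
    then show "B' \<in> T \<or> B \<notin> T" using upset_of_coalitionsD[OF T] by blast
  next
    fix B h u assume B: "B \<subseteq> N" and h: "h \<in> {1..<p}" "A u = h - 1" and u: "u \<in> Xstar"
    \<comment> \<open>Here \<open>Suc (A u) = h < p\<close>, so the convention for the top category
      does not apply.\<close>
    have "?O u h \<notin> T" using A(2)[OF u] h by auto
    \<comment> \<open>If clause (4) failed, \<open>B\<close> would be a member of \<open>T\<close>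
      inside \<open>?O u h\<close>, putting \<open>?O u h\<close> in \<open>T\<close> as
      well.\<close>
    moreover have "B \<subseteq> ?O u h" if "\<forall>i\<in>B. ?x i h (u i)"
      using B that unfolding outranking_coalition_def by blast
    ultimately show "(\<exists>i\<in>B. \<not> ?x i h (u i)) \<or> B \<notin> T"
      using upset_of_coalitionsD[OF T _ _ outranking_coalition_subset] by blast
  next
    fix B h a assume h: "h \<in> {1..<p}" "A a = h" and a: "a \<in> Xstar"
    \<comment> \<open>Since \<open>h\<close> is at least 1, the convention for the bottom category
      does not apply.\<close>
    have "?O a h \<in> T" using A(1)[OF a] h by auto
    \<comment> \<open>When all \<open>x\<close> literals over \<open>B\<close> are false,
      \<open>?O a h\<close> avoids \<open>B\<close>, so the upset property passes membership on to
      \<open>N - B\<close>.\<close>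
    moreover have "?O a h \<subseteq> N - B" if "\<not> (\<exists>i\<in>B. ?x i h (a i))"
      using that unfolding outranking_coalition_def by blast
    ultimately show "(\<exists>i\<in>B. ?x i h (a i)) \<or> N - B \<in> T"
      using upset_of_coalitionsD[OF T] by blast
  qed
  then show False using assms(7) unfolding phi_SAT_satisfiable_def by blast
qed

end
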